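(* Let $(X,d)$ be an unbounded $C_U$-uniform space equipped with a doubling Borel regular measure $\mu$, let $b\in\partial X$, $|x|:=d(b,x)$, and $\sigma>0$. Let $\rho:(0,\infty)\to(0,\infty)$ be a Borel measurable function with $\int_0^\infty\rho(t)\,dt<\infty$ such that, for some positive constants $C_A,C_B$, (A) $\rho(r)\le C_A\,\rho(s)$ whenever $0<r\le 2s+1$ and $0<s\le 2r+1$; (B) $\int_r^\infty\rho(t)\,dt\le C_B(r+1)\rho(r)$ for every $r>0$. Assume also that $$\sup_{r>0}\frac{\int_{X\setminus B(b,r)}\rho(|x|)^\sigma\,d\mu(x)}{\rho(r)^\sigma\,\mu(B(b,r+1))}=\infty.$$ Then the measure $\mu_\rho$, defined by $\mu_\rho(A)=\int_A\rho(|x|)^\sigma\,d\mu(x)$, is not doubling in the space $(X,d_\rho)$.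
   Context: $\overline X^d$ is the completion of $(X,d)$ and $\partial X=\overline X^d\setminus X$; $B(x,r)=\{y\in X:d(x,y)<r\}$ for $x\in\overline X^d$. A curve is a continuous map $\gamma$ from a compact interval; its length $\ell_d(\gamma)$ is the supremum of sums of consecutive distances over partitions; it is rectifiable if its length is finite. $(X,d)$ is $C_U$-uniform ($C_U\ge1$) if it is locally compact, not complete, and any two points $x,y\in X$ can be connected by a curve $\gamma:[s,u]\to X$ with (i) $\ell_d(\gamma)\le C_Ud(x,y)$ and (ii) $\min\{\ell_d(\gamma|_{[s,t]}),\ell_d(\gamma|_{[t,u]})\}\le C_U\inf_{w\in\partial X}d(\gamma(t),w)$ for every $t\in[s,u]$. The sphericalized metric is $d_\rho(x,y)=\inf_\gamma\int_\gamma\rho(|\cdot|)\,ds$, the infimum over all curves in $X$, rectifiable with respect to $d$, with end points $x,y$; $ds$ is arc length with respect to $d$. $\mu$ doubling means there is $C_\mu>1$ with $0<\mu(B(x,2r))\le C_\mu\mu(B(x,r))<\infty$ for all $x\in X$, $r>0$. $\mu_\rho$ is doubling in $(X,d_\rho)$ if there is $C>1$ with $0<\mu_\rho(B_\rho(x,2r))\le C\mu_\rho(B_\rho(x,r))<\infty$ for all $x\in X$, $r>0$, where $B_\rho(x,r)=\{y\in X:d_\rho(x,y)<r\}$. *)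

theory Defs
  imports "HOL-Analysis.Analysis"
begin

text \<open>
  The metric space \<open>(X,d)\<close> is a subset \<open>X\<close> of a type of class \<open>complete_space\<close>, with \<open>d\<close> the
  restriction of \<^const>\<open>dist\<close>; its completion is then \<^term>\<open>closure X\<close>.  No generality is lost:
  every metric space embeds isometrically into the bounded continuous functions on it (Kuratowski
  embedding), which form a complete space.
\<close>

definition bdry :: "'a::complete_space set \<Rightarrow> 'a set" where
  "bdry X = closure X - X"

definition sball :: "'a::complete_space set \<Rightarrow> 'a \<Rightarrow> real \<Rightarrow> 'a set" where
  "sball X x r = {y \<in> X. dist x y < r}"

definition curve_in :: "'a::complete_space set \<Rightarrow> (real \<Rightarrow> 'a) \<Rightarrow> real \<Rightarrow> real \<Rightarrow> bool" where
  "curve_in X \<gamma> s u \<longleftrightarrow> s \<le> u \<and> continuous_on {s..u} \<gamma> \<and> \<gamma> ` {s..u} \<subseteq> X"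

text \<open>The pair \<open>(n, p)\<close> encodes the partition \<open>s = p 0 \<le> p 1 \<le> \<dots> \<le> p n = u\<close>.\<close>

definition curve_length :: "(real \<Rightarrow> 'a::complete_space) \<Rightarrow> real \<Rightarrow> real \<Rightarrow> ennreal" where
  "curve_length \<gamma> s u =
     (SUP (n, p) \<in> {(n::nat, p::nat \<Rightarrow> real). p 0 = s \<and> p n = u \<and> mono_on {..n} p}.
        ennreal (\<Sum>i<n. dist (\<gamma> (p i)) (\<gamma> (p (Suc i)))))"

definition rectifiable :: "(real \<Rightarrow> 'a::complete_space) \<Rightarrow> real \<Rightarrow> real \<Rightarrow> bool" where
  "rectifiable \<gamma> s u \<longleftrightarrow> curve_length \<gamma> s u < \<infinity>"

text \<open>
  Arc length parametrization of a rectifiable curve.  The choice of \<open>t\<close> is immaterial, since \<open>\<gamma>\<close> is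
  constant on every interval on which the length function \<open>t \<mapsto> curve_length \<gamma> s t\<close> is constant.
\<close>

definition arclength_param :: "(real \<Rightarrow> 'a::complete_space) \<Rightarrow> real \<Rightarrow> real \<Rightarrow> real \<Rightarrow> 'a" where
  "arclength_param \<gamma> s u \<tau> = \<gamma> (SOME t. t \<in> {s..u} \<and> curve_length \<gamma> s t = ennreal \<tau>)"

text \<open>The integral \<open>\<integral>\<^sub>\<gamma> f ds\<close> with respect to arc length; meaningful for rectifiable curves only.\<close>

definition curve_integral ::
    "('a::complete_space \<Rightarrow> ennreal) \<Rightarrow> (real \<Rightarrow> 'a) \<Rightarrow> real \<Rightarrow> real \<Rightarrow> ennreal" where
  "curve_integral f \<gamma> s u =
     (\<integral>\<^sup>+ \<tau> \<in> {0..enn2real (curve_length \<gamma> s u)}. f (arclength_param \<gamma> s u \<tau>) \<partial>lborel)"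

text \<open>
  Here \<^const>\<open>infdist\<close> is the infimum of distances: \<^term>\<open>bdry X\<close> is nonempty because \<open>X\<close> is not
  complete.
\<close>

definition uniform_metric :: "real \<Rightarrow> 'a::complete_space set \<Rightarrow> bool" where
  "uniform_metric C X \<longleftrightarrow>
     C \<ge> 1 \<and> locally compact X \<and> \<not> complete X \<and>
     (\<forall>x\<in>X. \<forall>y\<in>X. \<exists>\<gamma> s u. curve_in X \<gamma> s u \<and> \<gamma> s = x \<and> \<gamma> u = y \<and>
        curve_length \<gamma> s u \<le> ennreal (C * dist x y) \<and>
        (\<forall>t\<in>{s..u}. min (curve_length \<gamma> s t) (curve_length \<gamma> t u)
                      \<le> ennreal (C * infdist (\<gamma> t) (bdry X))))"

text \<open>
  The sphericalized metric with base point \<open>b\<close>, where \<open>|x| = dist b x\<close>.  It is kept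
  \<^typ>\<open>ennreal\<close>-valued, so that no junk value can arise from the infimum.
\<close>

definition sph_dist ::
    "(real \<Rightarrow> real) \<Rightarrow> 'a::complete_space \<Rightarrow> 'a set \<Rightarrow> 'a \<Rightarrow> 'a \<Rightarrow> ennreal" where
  "sph_dist \<rho> b X x y =
     (INF (\<gamma>, s, u) \<in> {(\<gamma>, s, u). curve_in X \<gamma> s u \<and> rectifiable \<gamma> s u \<and> \<gamma> s = x \<and> \<gamma> u = y}.
        curve_integral (\<lambda>z. ennreal (\<rho> (dist b z))) \<gamma> s u)"

definition sph_ball ::
    "(real \<Rightarrow> real) \<Rightarrow> 'a::complete_space \<Rightarrow> 'a set \<Rightarrow> 'a \<Rightarrow> real \<Rightarrow> 'a set" where
  "sph_ball \<rho> b X x r = {y \<in> X. sph_dist \<rho> b X x y < ennreal r}"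

definition sph_measure ::
    "(real \<Rightarrow> real) \<Rightarrow> 'a::complete_space \<Rightarrow> real \<Rightarrow> 'a measure \<Rightarrow> 'a measure" where
  "sph_measure \<rho> b \<sigma> M = density M (\<lambda>x. ennreal (\<rho> (dist b x) powr \<sigma>))"

text \<open>
  A Borel regular measure on \<open>X\<close>, viewed on its \<open>\<sigma>\<close>-algebra of measurable sets, which may be larger
  than the Borel \<open>\<sigma>\<close>-algebra of \<open>X\<close>.
\<close>

definition borel_regular_on :: "'a::complete_space set \<Rightarrow> 'a measure \<Rightarrow> bool" where
  "borel_regular_on X M \<longleftrightarrow>
     space M = X \<and> sets (restrict_space borel X) \<subseteq> sets M \<and>
     (\<forall>A\<in>sets M. \<exists>B\<in>sets (restrict_space borel X). A \<subseteq> B \<and> emeasure M B = emeasure M A)"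

text \<open>
  Doubling with respect to a family of balls \<open>B x r\<close>; used both with the balls \<open>sball X\<close> of \<open>(X,d)\<close>
  and with those of the sphericalized metric.
\<close>

definition doubling :: "'a set \<Rightarrow> ('a \<Rightarrow> real \<Rightarrow> 'a set) \<Rightarrow> 'a measure \<Rightarrow> bool" where
  "doubling X B M \<longleftrightarrow>
     (\<exists>C>1. \<forall>x\<in>X. \<forall>r>0. 0 < emeasure M (B x (2 * r)) \<and>
        emeasure M (B x (2 * r)) \<le> ennreal C * emeasure M (B x r) \<and>
        ennreal C * emeasure M (B x r) < \<infinity>)"

end

theory Submission
  imports Defs
begin

text \<open>
  Suppose that \<open>\<mu>\<^sub>\<rho>\<close> were doubling.  In the sphericalized metric the whole end
  \<open>X - B(b,r)\<close> looks like a single ball.  Put \<open>q = r / 2\<close>, choose \<open>x\<close> with \<open>|x| = q\<close>, and measure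
  \<open>d\<^sub>\<rho>\<close>-distances from \<open>x\<close> in units of \<open>(q + 1) \<rho>(q)\<close>.

  A small ball.  By condition (A), leaving the \<open>d\<close>-ball \<open>B(x, (q + 1) / 2)\<close> costs at least a fixed
  multiple of the unit (\<open>sph_dist_lower_bound\<close>).  So there is a \<open>d\<^sub>\<rho>\<close>-ball about \<open>x\<close>, with radius a
  fixed multiple of the unit, inside that \<open>d\<close>-ball and hence inside \<open>B(b, r + 1)\<close>.
  There the weight is at most a constant times \<open>\<rho>(r)\<close>, so the \<open>\<mu>\<^sub>\<rho>\<close>-measure of the small ball is
  at most a constant times \<open>\<rho>(r)\<^sup>\<sigma> \<mu>(B(b, r + 1))\<close>.

  A large ball.  Every \<open>y\<close> with \<open>|y| \<ge> q\<close> is within a fixed multiple of the unit from \<open>x\<close>.  Indeed,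
  along a uniform curve from \<open>x\<close> to \<open>y\<close> the distance to \<open>b\<close> grows at least linearly in the arc length
  from the nearer end point, up to the shift by 1, so the curve costs no more than a constant times the
  two tails \<open>\<integral> \<rho>\<close> beyond \<open>|x|\<close> and beyond \<open>|y|\<close> (\<open>sph_dist_upper_bound\<close>), and condition (B)
  bounds both by the unit.

  The radii of the two balls have a ratio independent of \<open>r\<close>, so a fixed number of doublings compares
  their measures.  As the large ball contains \<open>X - B(b,r)\<close>, the quotients in the hypothesis are
  bounded, which contradicts that their supremum is infinite.

  Both metric estimates evaluate integrals in the arc length parameter and therefore need a point of
  the curve at every arc length, that is, continuity of the length function of a rectifiable curve
  (\<open>curve_length_continuous\<close>).
\<close>

section \<open>Length of curves and points at prescribed arc length\<close>

definition subdivision :: "nat \<Rightarrow> (nat \<Rightarrow> real) \<Rightarrow> real \<Rightarrow> real \<Rightarrow> bool" where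
  "subdivision n p s u \<longleftrightarrow> p 0 = s \<and> p n = u \<and> mono_on {..n} p"

definition inscribed_length :: "(real \<Rightarrow> 'a::metric_space) \<Rightarrow> nat \<Rightarrow> (nat \<Rightarrow> real) \<Rightarrow> real" where
  "inscribed_length \<gamma> n p = (\<Sum>i<n. dist (\<gamma> (p i)) (\<gamma> (p (Suc i))))"

lemma curve_length_eq_SUP_inscribed:
  "curve_length \<gamma> s u =
     (SUP (n, p) \<in> {(n, p). subdivision n p s u}. ennreal (inscribed_length \<gamma> n p))"
  by (simp add: curve_length_def subdivision_def inscribed_length_def)

lemma inscribed_le_curve_length:
  "subdivision n p s u \<Longrightarrow> ennreal (inscribed_length \<gamma> n p) \<le> curve_length \<gamma> s u"
  unfolding curve_length_eq_SUP_inscribed by (rule SUP_upper2[where i="(n, p)"]) auto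

lemma curve_length_least:
  "(\<And>n p. subdivision n p s u \<Longrightarrow> ennreal (inscribed_length \<gamma> n p) \<le> c) \<Longrightarrow> curve_length \<gamma> s u \<le> c"
  unfolding curve_length_eq_SUP_inscribed by (rule SUP_least) auto

lemma inscribed_length_nonneg: "0 \<le> inscribed_length \<gamma> n p"
  by (simp add: inscribed_length_def sum_nonneg)

lemma subdivision_mem: "subdivision n p s u \<Longrightarrow> i \<le> n \<Longrightarrow> p i \<in> {s..u}"
  unfolding subdivision_def mono_on_def by fastforce

lemma subdivision_trivial:
  "s \<le> u \<Longrightarrow> subdivision (Suc 0) (\<lambda>i. if i = 0 then s else u) s u"
  unfolding subdivision_def mono_on_def by auto

lemma dist_le_curve_length: "s \<le> u \<Longrightarrow> ennreal (dist (\<gamma> s) (\<gamma> u)) \<le> curve_length \<gamma> s u"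
  using inscribed_le_curve_length[OF subdivision_trivial[of s u], of \<gamma>]
  by (simp add: inscribed_length_def)

lemma curve_length_trivial [simp]: "curve_length \<gamma> s s = 0"
proof -
  have "curve_length \<gamma> s s \<le> 0"
  proof (rule curve_length_least)
    fix n p assume p: "subdivision n p s s"
    have "p i = s" if "i \<le> n" for i
      using subdivision_mem[OF p that] by simp
    then show "ennreal (inscribed_length \<gamma> n p) \<le> 0"
      by (simp add: inscribed_length_def)
  qed
  then show ?thesis by simp
qed

text \<open>
  Truncating the points of a subdivision at \<open>t\<close>, from above by \<open>min\<close> and from below by \<open>max\<close>,
  cuts it at \<open>t\<close> without renumbering; the repeated points contribute nothing to inscribed lengths.
  A further advantage over inserting \<open>t\<close> is that the truncated points depend continuously on \<open>t\<close>.
\<close>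

lemma subdivision_min: "subdivision n p s u \<Longrightarrow> t \<in> {s..u} \<Longrightarrow> subdivision n (\<lambda>i. min (p i) t) s t"
  unfolding subdivision_def mono_on_def by (auto simp: min_def) (meson order_trans)+

lemma subdivision_max: "subdivision n p s u \<Longrightarrow> t \<in> {s..u} \<Longrightarrow> subdivision n (\<lambda>i. max (p i) t) t u"
  unfolding subdivision_def mono_on_def by (auto simp: max_def) (meson order_trans)+

lemma inscribed_length_cut:
  assumes "subdivision n p s u"
  shows "inscribed_length \<gamma> n p
    \<le> inscribed_length \<gamma> n (\<lambda>i. min (p i) t) + inscribed_length \<gamma> n (\<lambda>i. max (p i) t)"
  unfolding inscribed_length_def sum.distrib[symmetric]
proof (rule sum_mono)
  fix i assume "i \<in> {..<n}"
  with assms have "p i \<le> p (Suc i)"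
    by (auto simp: subdivision_def mono_on_def)
  then consider "p (Suc i) \<le> t" | "t \<le> p i" | "p i \<le> t" "t \<le> p (Suc i)" by linarith
  then show "dist (\<gamma> (p i)) (\<gamma> (p (Suc i)))
    \<le> dist (\<gamma> (min (p i) t)) (\<gamma> (min (p (Suc i)) t))
      + dist (\<gamma> (max (p i) t)) (\<gamma> (max (p (Suc i)) t))"
    using \<open>p i \<le> p (Suc i)\<close> by cases (auto simp: min_absorb1 max_absorb1 max_absorb2 min_absorb2 dist_triangle)
qed

text \<open>
  Subdivisions of the two halves concatenate.
\<close>

lemma curve_length_superadditive:
  assumes "s \<le> t" "t \<le> u"
  shows "curve_length \<gamma> s t + curve_length \<gamma> t u \<le> curve_length \<gamma> s u"
proof -
  have ne: "{(n, p). subdivision n p s u} \<noteq> {}" if "s \<le> u" for s u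
    using subdivision_trivial[OF that] by blast
  have concat: "ennreal (inscribed_length \<gamma> n p) + ennreal (inscribed_length \<gamma> m q)
      \<le> curve_length \<gamma> s u"
    if p: "subdivision n p s t" and q: "subdivision m q t u" for n p m q
  proof -
    define r where "r i = (if i \<le> n then p i else q (i - n))" for i
    have qn: "r (n + j) = q j" for j
      using p q by (auto simp: r_def subdivision_def)
    have "r i \<le> r j" if "i \<le> j" "j \<le> n + m" for i j
    proof (cases "i \<le> n \<and> n < j")
      case True
      then have "r i \<le> t" "t \<le> r j"
        using that subdivision_mem[OF p, of i] subdivision_mem[OF q, of "j - n"]
        by (auto simp: r_def)
      then show ?thesis by simp
    next
      case False
      then show ?thesis
        using that p q by (auto simp: r_def subdivision_def intro: mono_onD diff_le_mono)
    qed
    then have "mono_on {..n + m} r" by (auto simp: mono_on_def)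
    moreover have "r 0 = s" "r (n + m) = u"
      using p q qn[of m] by (auto simp: r_def subdivision_def)
    ultimately have r: "subdivision (n + m) r s u"
      by (simp add: subdivision_def)
    have split: "(\<Sum>i<n + m. f i) = (\<Sum>i<n. f i) + (\<Sum>i<m. f (n + i))" for f :: "nat \<Rightarrow> real"
      by (induction m) auto
    have "inscribed_length \<gamma> (n + m) r = inscribed_length \<gamma> n p + inscribed_length \<gamma> m q"
      unfolding inscribed_length_def split
    proof (intro arg_cong2[where f="(+)"] sum.cong refl)
      show "dist (\<gamma> (r i)) (\<gamma> (r (Suc i))) = dist (\<gamma> (p i)) (\<gamma> (p (Suc i)))"
        if "i \<in> {..<n}" for i using that by (simp add: r_def)
      show "dist (\<gamma> (r (n + i))) (\<gamma> (r (Suc (n + i)))) = dist (\<gamma> (q i)) (\<gamma> (q (Suc i)))" for i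
        using qn[of i] qn[of "Suc i"] by simp
    qed
    then show ?thesis
      using inscribed_le_curve_length[OF r, of \<gamma>]
      by (simp add: ennreal_plus[symmetric] inscribed_length_nonneg del: ennreal_plus)
  qed
  have half: "ennreal (inscribed_length \<gamma> n p) + curve_length \<gamma> t u \<le> curve_length \<gamma> s u"
    if "subdivision n p s t" for n p
    unfolding curve_length_eq_SUP_inscribed[of _ t u] ennreal_SUP_add_right[OF ne[OF assms(2)]]
    by (rule SUP_least) (use concat[OF that] in auto)
  show ?thesis
    unfolding curve_length_eq_SUP_inscribed[of _ s t] ennreal_SUP_add_left[OF ne[OF assms(1)], symmetric]
    by (rule SUP_least) (use half in auto)
qed

text \<open>
  The converse inequality: cutting a subdivision at \<open>t\<close> does not decrease its inscribed length,
  by the triangle inequality.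
\<close>

lemma curve_length_additive:
  assumes "s \<le> t" "t \<le> u"
  shows "curve_length \<gamma> s t + curve_length \<gamma> t u = curve_length \<gamma> s u"
proof (rule antisym[OF curve_length_superadditive[OF assms]], rule curve_length_least)
  fix n p assume p: "subdivision n p s u"
  have t: "t \<in> {s..u}" using assms by simp
  have "ennreal (inscribed_length \<gamma> n p)
      \<le> ennreal (inscribed_length \<gamma> n (\<lambda>i. min (p i) t)) + ennreal (inscribed_length \<gamma> n (\<lambda>i. max (p i) t))"
    using inscribed_length_cut[OF p, of \<gamma> t]
    by (simp add: ennreal_plus[symmetric] inscribed_length_nonneg del: ennreal_plus)
  also have "\<dots> \<le> curve_length \<gamma> s t + curve_length \<gamma> t u"
    by (intro add_mono inscribed_le_curve_length subdivision_min[OF p t] subdivision_max[OF p t])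
  finally show "ennreal (inscribed_length \<gamma> n p) \<le> curve_length \<gamma> s t + curve_length \<gamma> t u" .
qed

lemma rectifiable_subcurves:
  assumes "rectifiable \<gamma> s u" "t \<in> {s..u}"
  obtains "curve_length \<gamma> s t = ennreal (enn2real (curve_length \<gamma> s t))"
    "curve_length \<gamma> t u = ennreal (enn2real (curve_length \<gamma> t u))"
    "enn2real (curve_length \<gamma> s t) + enn2real (curve_length \<gamma> t u) = enn2real (curve_length \<gamma> s u)"
proof -
  have eq: "curve_length \<gamma> s t + curve_length \<gamma> t u = curve_length \<gamma> s u"
    using assms by (intro curve_length_additive) auto
  then have "curve_length \<gamma> s t + curve_length \<gamma> t u < \<infinity>"
    using assms by (simp add: rectifiable_def)
  then have "curve_length \<gamma> s t < \<infinity>" "curve_length \<gamma> t u < \<infinity>"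
    by (auto simp: ennreal_add_eq_top less_top)
  then show ?thesis
    using that eq by (auto simp: enn2real_plus[symmetric])
qed

text \<open>
  For a subdivision \<open>p\<close> that is nearly optimal on the whole interval, the inscribed length of \<open>p\<close>
  truncated at \<open>t\<close> is at most the length up to \<open>t\<close>, and the same holds for the remaining pieces.
  Since the two lengths add up to the total one, both errors are at most the total error.
  Thus the length function is a uniform limit of truncated inscribed lengths, which are continuous
  in \<open>t\<close> because the curve is.
\<close>

lemma curve_length_continuous:
  assumes cont: "continuous_on {s..u} \<gamma>" and rect: "rectifiable \<gamma> s u" and "s \<le> u"
  shows "continuous_on {s..u} (\<lambda>t. enn2real (curve_length \<gamma> s t))"
proof -
  define V where "V t = enn2real (curve_length \<gamma> s t)" for t
  have Lfin: "curve_length \<gamma> s u = ennreal (V u)"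
    using rect by (simp add: V_def rectifiable_def)
  have approx: "\<exists>n p. subdivision n p s u \<and> V u - e < inscribed_length \<gamma> n p" if "e > 0" for e
  proof (rule ccontr)
    assume neg: "\<not> ?thesis"
    have "curve_length \<gamma> s u \<le> ennreal (V u - e)"
      by (rule curve_length_least) (use neg in \<open>force intro: ennreal_leI\<close>)
    moreover have "0 \<le> V u - e"
      using neg subdivision_trivial[OF \<open>s \<le> u\<close>] inscribed_length_nonneg
      by (meson not_less order_trans)
    ultimately show False
      using that unfolding Lfin by (simp add: ennreal_le_iff)
  qed
  have "\<forall>k. \<exists>n p. subdivision n p s u \<and> V u - inverse (real (Suc k)) < inscribed_length \<gamma> n p"
    using approx by simp
  then obtain n p where np: "\<And>k. subdivision (n k) (p k) s u"
      "\<And>k. V u - inverse (real (Suc k)) < inscribed_length \<gamma> (n k) (p k)"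
    by metis
  define F where "F k t = inscribed_length \<gamma> (n k) (\<lambda>i. min (p k i) t)" for k t
  have close: "\<bar>F k t - V t\<bar> < inverse (real (Suc k))" if t: "t \<in> {s..u}" for k t
  proof -
    obtain fin: "curve_length \<gamma> s t = ennreal (V t)"
      "curve_length \<gamma> t u = ennreal (enn2real (curve_length \<gamma> t u))"
      and sum: "V t + enn2real (curve_length \<gamma> t u) = V u"
      using rectifiable_subcurves[OF rect t] unfolding V_def by blast
    have "F k t \<le> V t"
      using inscribed_le_curve_length[OF subdivision_min[OF np(1) t], where \<gamma>=\<gamma>] fin(1)
      unfolding F_def by (metis V_def enn2real_nonneg ennreal_le_iff)
    moreover have "inscribed_length \<gamma> (n k) (\<lambda>i. max (p k i) t) \<le> enn2real (curve_length \<gamma> t u)"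
      using inscribed_le_curve_length[OF subdivision_max[OF np(1) t], where \<gamma>=\<gamma>] fin(2)
      by (metis enn2real_nonneg ennreal_le_iff)
    ultimately show ?thesis
      using inscribed_length_cut[OF np(1)[of k], of \<gamma> t] np(2)[of k] sum
      unfolding F_def by linarith
  qed
  have "continuous_on {s..u} (F k)" for k
    unfolding F_def inscribed_length_def
  proof (intro continuous_intros continuous_on_compose2[OF cont])
    fix i assume i: "i \<in> {..<n k}"
    show "(\<lambda>x. min (p k i) x) ` {s..u} \<subseteq> {s..u}"
      "(\<lambda>x. min (p k (Suc i)) x) ` {s..u} \<subseteq> {s..u}"
      using i subdivision_mem[OF np(1), of i k] subdivision_mem[OF np(1), of "Suc i" k] by auto
  qed
  moreover have "uniform_limit {s..u} F V sequentially"
  proof (rule uniform_limitI)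
    fix e :: real assume "e > 0"
    then obtain N where N: "inverse (real (Suc N)) < e" using reals_Archimedean by blast
    show "\<forall>\<^sub>F k in sequentially. \<forall>t\<in>{s..u}. dist (F k t) (V t) < e"
      unfolding eventually_sequentially
    proof (intro exI allI impI ballI)
      fix k t assume "N \<le> k" "t \<in> {s..u}"
      have "inverse (real (Suc k)) \<le> inverse (real (Suc N))"
        using \<open>N \<le> k\<close> by (intro le_imp_inverse_le) auto
      with close[OF \<open>t \<in> {s..u}\<close>, of k] N show "dist (F k t) (V t) < e"
        unfolding dist_real_def by linarith
    qed
  qed
  ultimately show ?thesis
    unfolding V_def[symmetric, abs_def]
    using uniform_limit_theorem[where F=sequentially and A="{s..u}" and f=F and l=V] by simp
qed

text \<open>
  Continuity of length and the intermediate value theorem show that every value of arc length is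
  attained, so that the choice in the definition of \<^const>\<open>arclength_param\<close> is never vacuous.
\<close>

lemma arclength_param_point:
  assumes cont: "continuous_on {s..u} \<gamma>" and rect: "rectifiable \<gamma> s u" and "s \<le> u"
    and \<tau>: "\<tau> \<in> {0..enn2real (curve_length \<gamma> s u)}"
  obtains t where "t \<in> {s..u}" "arclength_param \<gamma> s u \<tau> = \<gamma> t"
    "curve_length \<gamma> s t = ennreal \<tau>"
    "curve_length \<gamma> t u = ennreal (enn2real (curve_length \<gamma> s u) - \<tau>)"
proof -
  have "\<exists>t\<ge>s. t \<le> u \<and> enn2real (curve_length \<gamma> s t) = \<tau>"
    using curve_length_continuous[OF assms(1-3)] \<tau> \<open>s \<le> u\<close> by (intro IVT') auto
  then obtain t where "t \<in> {s..u}" "enn2real (curve_length \<gamma> s t) = \<tau>" by auto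
  then have "\<exists>t. t \<in> {s..u} \<and> curve_length \<gamma> s t = ennreal \<tau>"
    using rectifiable_subcurves[OF rect] by metis
  from someI_ex[OF this] obtain t where t: "t \<in> {s..u}" "curve_length \<gamma> s t = ennreal \<tau>"
    "arclength_param \<gamma> s u \<tau> = \<gamma> t"
    unfolding arclength_param_def by blast
  have "curve_length \<gamma> t u = ennreal (enn2real (curve_length \<gamma> s u) - \<tau>)"
    using t(2) \<tau> rectifiable_subcurves[OF rect t(1)]
    by (metis add_diff_cancel_left' atLeastAtMost_iff enn2real_ennreal)
  with t show ?thesis by (intro that)
qed

section \<open>Weights that are comparable at comparable distances\<close>

text \<open>
  With \<open>r' = r + 1\<close> and \<open>s' = s + 1\<close> the two conditions on \<open>r\<close> and \<open>s\<close> read \<open>s' / 2 \<le> r' \<le> 2 s'\<close>,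
  so this is a doubling condition for \<open>\<rho>\<close> with respect to the shifted variable.
\<close>

definition quasi_constant :: "real \<Rightarrow> (real \<Rightarrow> real) \<Rightarrow> bool" where
  "quasi_constant C \<rho> \<longleftrightarrow> (\<forall>t>0. \<rho> t > 0) \<and>
     (\<forall>r s. 0 < r \<longrightarrow> r \<le> 2 * s + 1 \<longrightarrow> 0 < s \<longrightarrow> s \<le> 2 * r + 1 \<longrightarrow> \<rho> r \<le> C * \<rho> s)"

lemma quasi_constant_pos: "quasi_constant C \<rho> \<Longrightarrow> t > 0 \<Longrightarrow> \<rho> t > 0"
  by (simp add: quasi_constant_def)

lemma quasi_constantD:
  "quasi_constant C \<rho> \<Longrightarrow> 0 < r \<Longrightarrow> r \<le> 2 * s + 1 \<Longrightarrow> 0 < s \<Longrightarrow> s \<le> 2 * r + 1 \<Longrightarrow> \<rho> r \<le> C * \<rho> s"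
  by (simp add: quasi_constant_def)

lemma quasi_constant_ge_1: "quasi_constant C \<rho> \<Longrightarrow> C \<ge> 1"
  using quasi_constantD[of C \<rho> 1 1] quasi_constant_pos[of C \<rho> 1] by simp

text \<open>
  Shifted distances that differ by a factor of at most \<open>2 ^ k\<close> are joined by \<open>k\<close> steps of factor at
  most 2; the induction moves \<open>r\<close> towards \<open>s\<close> by halving or doubling \<open>r + 1\<close>.
\<close>

lemma quasi_constant_iterate:
  assumes qc: "quasi_constant C \<rho>" and "0 < r" "0 < s"
    and "r + 1 \<le> 2 ^ k * (s + 1)" "s + 1 \<le> 2 ^ k * (r + 1)"
  shows "\<rho> r \<le> C ^ k * \<rho> s"
  using assms(2-)
proof (induction k arbitrary: r)
  case 0
  then show ?case by simp
next
  case (Suc k)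
  have C: "C \<ge> 1" by (rule quasi_constant_ge_1[OF qc])
  have two: "(1::real) \<le> 2 ^ k" by simp
  have step: "\<rho> r \<le> C ^ Suc k * \<rho> s"
    if "0 < m" "r \<le> 2 * m + 1" "m \<le> 2 * r + 1" "m + 1 \<le> 2 ^ k * (s + 1)" "s + 1 \<le> 2 ^ k * (m + 1)"
    for m
  proof -
    have "\<rho> r \<le> C * \<rho> m" using that Suc.prems by (intro quasi_constantD[OF qc]) auto
    also have "\<dots> \<le> C * (C ^ k * \<rho> s)"
      using that C Suc.prems by (intro mult_left_mono Suc.IH) auto
    finally show ?thesis by simp
  qed
  have grow: "a \<le> 2 ^ k * a" if "0 \<le> a" for a :: real
    using mult_right_mono[OF two that] by simp
  consider "r \<le> 2 * s + 1" "s \<le> 2 * r + 1" | "r > 2 * s + 1" | "s > 2 * r + 1" by linarith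
  then show ?case
  proof cases
    case 1
    then show ?thesis using step[of s] grow[of "s + 1"] Suc.prems by auto
  next
    case 2
    show ?thesis
      by (rule step[of "(r - 1) / 2"]) (use 2 Suc.prems grow[of "(r - 1) / 2 + 1"] in \<open>auto simp: field_simps\<close>)
  next
    case 3
    show ?thesis
      by (rule step[of "2 * r + 1"]) (use 3 Suc.prems grow[of "s + 1"] in \<open>auto simp: field_simps\<close>)
  qed
qed

section \<open>Estimates for the sphericalized metric\<close>

lemma dist_bdry_pos: "b \<in> bdry X \<Longrightarrow> z \<in> X \<Longrightarrow> 0 < dist b z"
  by (auto simp: bdry_def)

text \<open>
  A curve that leaves the ball of radius \<open>R = (|x| + 1) / 2\<close> about \<open>x\<close> has length at least \<open>R\<close>, and
  its initial piece of length \<open>R\<close> stays in that ball, where \<open>\<rho>(|z|) \<ge> \<rho>(|x|) / C\<close>.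
  The radius is the largest one for which the triangle inequality brings \<open>|x|\<close> and \<open>|z|\<close> into the
  range where \<^const>\<open>quasi_constant\<close> compares \<open>\<rho>\<close> directly.
\<close>

lemma sph_dist_lower_bound:
  assumes qc: "quasi_constant C \<rho>" and b: "b \<in> bdry X"
    and far: "(dist b x + 1) / 2 \<le> dist x y"
  shows "ennreal ((dist b x + 1) / 2 * (\<rho> (dist b x) / C)) \<le> sph_dist \<rho> b X x y"
  unfolding sph_dist_def
proof (rule INF_greatest, unfold split_paired_all mem_Collect_eq prod.case, elim conjE)
  fix \<gamma> :: "real \<Rightarrow> 'a" and s u
  assume cur: "curve_in X \<gamma> s u" and rect: "rectifiable \<gamma> s u" 
    and ends: "\<gamma> s = x" "\<gamma> u = y"
  note ends[symmetric, simp]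
  let ?R = "(dist b (\<gamma> s) + 1) / 2" and ?L = "enn2real (curve_length \<gamma> s u)"
  let ?c = "\<rho> (dist b (\<gamma> s)) / C"
  have su: "s \<le> u" "continuous_on {s..u} \<gamma>" and inX: "\<And>t. t \<in> {s..u} \<Longrightarrow> \<gamma> t \<in> X"
    using cur by (auto simp: curve_in_def)
  have C: "C \<ge> 1" by (rule quasi_constant_ge_1[OF qc])
  have "ennreal (dist (\<gamma> s) (\<gamma> u)) \<le> ennreal ?L"
    using dist_le_curve_length[OF su(1), of \<gamma>] rect by (simp add: rectifiable_def)
  then have L: "?R \<le> ?L"
    using far by (auto simp: ennreal_le_iff)
  have R: "0 \<le> ?R" by (simp add: add_nonneg_nonneg)
  have pos: "0 < dist b (\<gamma> t)" if "t \<in> {s..u}" for t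
    by (rule dist_bdry_pos[OF b inX[OF that]])
  have near: "?c \<le> \<rho> (dist b (arclength_param \<gamma> s u \<tau>))" if "\<tau> \<in> {0..<?R}" for \<tau>
  proof -
    have "\<tau> \<in> {0..?L}" using that L by simp
    then obtain t where t: "t \<in> {s..u}" "arclength_param \<gamma> s u \<tau> = \<gamma> t"
        "curve_length \<gamma> s t = ennreal \<tau>"
      by (rule arclength_param_point[OF su(2) rect su(1)])
    have "ennreal (dist (\<gamma> s) (\<gamma> t)) \<le> ennreal \<tau>"
      using dist_le_curve_length[of s t \<gamma>] t by simp
    then have "dist (\<gamma> s) (\<gamma> t) < ?R"
      using that by (simp add: ennreal_le_iff)
    then have "dist b (\<gamma> s) \<le> 2 * dist b (\<gamma> t) + 1" "dist b (\<gamma> t) \<le> 2 * dist b (\<gamma> s) + 1"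
      using dist_triangle[of b "\<gamma> s" "\<gamma> t"] dist_triangle[of b "\<gamma> t" "\<gamma> s"]
      unfolding dist_commute[of "\<gamma> t" "\<gamma> s"] by argo+
    then have "\<rho> (dist b (\<gamma> s)) \<le> C * \<rho> (dist b (\<gamma> t))"
      using pos t(1) su(1) by (intro quasi_constantD[OF qc]) auto
    then show ?thesis using C t(2) by (simp add: field_simps)
  qed
  have c: "0 \<le> ?c"
    using quasi_constant_pos[OF qc pos[of s]] su(1) C by simp
  have "ennreal (?R * ?c) = (\<integral>\<^sup>+\<tau>. ennreal ?c * indicator {0..<?R} \<tau> \<partial>lborel)"
    using R ennreal_mult[OF c R] by (simp add: nn_integral_cmult_indicator mult.commute)
  also have "\<dots> \<le> curve_integral (\<lambda>z. ennreal (\<rho> (dist b z))) \<gamma> s u"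
    unfolding curve_integral_def
    by (rule nn_integral_mono) (use near L in \<open>auto split: split_indicator intro!: ennreal_leI\<close>)
  finally show "ennreal ((dist b x + 1) / 2 * (\<rho> (dist b x) / C))
      \<le> curve_integral (\<lambda>z. ennreal (\<rho> (dist b z))) \<gamma> s u" by simp
qed

lemma sph_ball_subset_sball:
  assumes "quasi_constant C \<rho>" "b \<in> bdry X"
  shows "sph_ball \<rho> b X x ((dist b x + 1) / 2 * (\<rho> (dist b x) / C)) \<subseteq> sball X x ((dist b x + 1) / 2)"
  using sph_dist_lower_bound[OF assms] by (fastforce simp: sph_ball_def sball_def not_less[symmetric])

lemma measurable_tail:
  fixes \<rho> :: "real \<Rightarrow> real"
  assumes "\<rho> \<in> borel_measurable (restrict_space borel {0<..})" and "0 \<le> a"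
  shows "(\<lambda>t. ennreal (\<rho> t) * indicator {a<..} t) \<in> borel_measurable borel"
proof -
  have [measurable]: "(\<lambda>t. indicator {0<..} t * \<rho> t) \<in> borel_measurable borel"
    using assms(1) by (subst (asm) borel_measurable_restrict_space_iff) simp_all
  have "(\<lambda>t. ennreal (\<rho> t) * indicator {a<..} t)
      = (\<lambda>t. ennreal (indicator {0<..} t * \<rho> t) * indicator {a<..} t)"
    using assms(2) by (auto simp: fun_eq_iff split: split_indicator)
  then show ?thesis by simp
qed

text \<open>
  Let \<open>z\<close> be the point at arc length \<open>\<tau>\<close> from the end point \<open>x\<close> of a uniform curve, on the half closer
  to \<open>x\<close>.  As \<open>b\<close> is a boundary point, the twisted cone condition gives \<open>\<tau> \<le> U |z|\<close>; together with
  \<open>d(x,z) \<le> \<tau>\<close> this makes \<open>|z| + 1\<close> comparable to \<open>|x| + \<tau> + 1\<close>.  Hence \<open>\<rho>(|z|)\<close> is controlled by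
  \<open>\<rho>(|x| + \<tau>)\<close>, as if the curve were running radially away from \<open>b\<close>, and integrating in \<open>\<tau>\<close> gives the
  tail of \<open>\<rho>\<close> beyond \<open>|x|\<close>.  The other half is the same with the other end point.
\<close>

lemma curve_integral_uniform_le:
  assumes qc: "quasi_constant C \<rho>" and b: "b \<in> bdry X"
    and meas: "\<rho> \<in> borel_measurable (restrict_space borel {0<..})"
    and cur: "curve_in X \<gamma> s u" and rect: "rectifiable \<gamma> s u"
    and U: "0 \<le> U" "1 + 2 * U \<le> 2 ^ k"
    and cone: "\<And>t. t \<in> {s..u} \<Longrightarrow>
      min (curve_length \<gamma> s t) (curve_length \<gamma> t u) \<le> ennreal (U * infdist (\<gamma> t) (bdry X))"
  shows "curve_integral (\<lambda>z. ennreal (\<rho> (dist b z))) \<gamma> s u \<le> ennreal (C ^ k) *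
    ((\<integral>\<^sup>+ t \<in> {dist b (\<gamma> s)<..}. ennreal (\<rho> t) \<partial>lborel)
      + (\<integral>\<^sup>+ t \<in> {dist b (\<gamma> u)<..}. ennreal (\<rho> t) \<partial>lborel))"
proof -
  let ?L = "enn2real (curve_length \<gamma> s u)" and ?p = "dist b (\<gamma> s)" and ?q = "dist b (\<gamma> u)"
  define h where "h a t = ennreal (\<rho> t) * indicator {a<..} t" for a t :: real
  have [measurable]: "h a \<in> borel_measurable borel" if "0 \<le> a" for a
    unfolding h_def by (rule measurable_tail[OF meas that])
  have su: "s \<le> u" "continuous_on {s..u} \<gamma>" and inX: "\<And>t. t \<in> {s..u} \<Longrightarrow> \<gamma> t \<in> X"
    using cur by (auto simp: curve_in_def)
  have pos: "0 < dist b (\<gamma> t)" if "t \<in> {s..u}" for t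
    by (rule dist_bdry_pos[OF b inX[OF that]])
  \<comment> \<open>\<open>w\<close> is the nearer end point of the curve and \<open>l\<close> the arc length between \<open>w\<close> and \<open>z\<close>\<close>
  have compare: "\<rho> (dist b z) \<le> C ^ k * \<rho> (dist b w + l)"
    if "0 < dist b z" "0 < dist b w" "0 \<le> l" "dist w z \<le> l" "l \<le> U * dist b z" for z w l
  proof (rule quasi_constant_iterate[OF qc])
    have "dist b w + l + 1 \<le> (1 + 2 * U) * (dist b z + 1)"
      using that U dist_triangle[of b w z] by (simp add: algebra_simps dist_commute)
    also have "\<dots> \<le> 2 ^ k * (dist b z + 1)"
      using U that by (intro mult_right_mono) auto
    finally show "dist b w + l + 1 \<le> 2 ^ k * (dist b z + 1)" .
    have "dist b z + 1 \<le> 1 * (dist b w + l + 1)"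
      using that dist_triangle[of b z w] by simp
    also have "\<dots> \<le> 2 ^ k * (dist b w + l + 1)"
      using that by (intro mult_right_mono) auto
    finally show "dist b z + 1 \<le> 2 ^ k * (dist b w + l + 1)" .
  qed (use that in \<open>auto intro: add_pos_nonneg\<close>)
  \<comment> \<open>The tails of \<open>\<rho>\<close> are taken over open half-lines, so the bound can fail at \<open>\<tau> = 0\<close> and \<open>\<tau> = L\<close>.\<close>
  have point: "ennreal (\<rho> (dist b (arclength_param \<gamma> s u \<tau>))) * indicator {0..?L} \<tau>
      \<le> ennreal (C ^ k) * (h ?p (?p + 1 * \<tau>) + h ?q ((?q + ?L) + (-1) * \<tau>))"
    if "\<tau> \<noteq> 0" "\<tau> \<noteq> ?L" for \<tau>
  proof (cases "\<tau> \<in> {0..?L}")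
    case True
    with that have \<tau>: "0 < \<tau>" "\<tau> < ?L" by auto
    obtain t where t: "t \<in> {s..u}" "arclength_param \<gamma> s u \<tau> = \<gamma> t"
      "curve_length \<gamma> s t = ennreal \<tau>" "curve_length \<gamma> t u = ennreal (?L - \<tau>)"
      using arclength_param_point[OF su(2) rect su(1) True] .
    have "U * infdist (\<gamma> t) (bdry X) \<le> U * dist b (\<gamma> t)"
      using infdist_le[OF b, of "\<gamma> t"] U by (intro mult_left_mono) (auto simp: dist_commute)
    then have "min (ennreal \<tau>) (ennreal (?L - \<tau>)) \<le> ennreal (U * dist b (\<gamma> t))"
      using order_trans[OF cone[OF t(1)] ennreal_leI] t by simp
    then consider "\<tau> \<le> U * dist b (\<gamma> t)" | "?L - \<tau> \<le> U * dist b (\<gamma> t)"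
      using U by (auto simp: min_le_iff_disj ennreal_le_iff)
    then have "ennreal (\<rho> (dist b (\<gamma> t)))
      \<le> ennreal (C ^ k) * (ennreal (\<rho> (?p + \<tau>)) + ennreal (\<rho> (?q + (?L - \<tau>))))"
    proof cases
      case 1
      have "ennreal (dist (\<gamma> s) (\<gamma> t)) \<le> ennreal \<tau>"
        using dist_le_curve_length[of s t \<gamma>] t by simp
      then have "\<rho> (dist b (\<gamma> t)) \<le> C ^ k * \<rho> (?p + \<tau>)"
        using 1 \<tau> pos t(1) su(1) by (intro compare) auto
      then have "ennreal (\<rho> (dist b (\<gamma> t))) \<le> ennreal (C ^ k) * ennreal (\<rho> (?p + \<tau>))"
        using quasi_constant_ge_1[OF qc] by (simp add: ennreal_mult'[symmetric] ennreal_leI)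
      then show ?thesis by (rule order_trans) (simp add: distrib_left)
    next
      case 2
      have "ennreal (dist (\<gamma> u) (\<gamma> t)) \<le> ennreal (?L - \<tau>)"
        using dist_le_curve_length[of t u \<gamma>] t by (simp add: dist_commute)
      then have "\<rho> (dist b (\<gamma> t)) \<le> C ^ k * \<rho> (?q + (?L - \<tau>))"
        using 2 \<tau> pos t(1) su(1) by (intro compare) auto
      then have "ennreal (\<rho> (dist b (\<gamma> t))) \<le> ennreal (C ^ k) * ennreal (\<rho> (?q + (?L - \<tau>)))"
        using quasi_constant_ge_1[OF qc] by (simp add: ennreal_mult'[symmetric] ennreal_leI)
      then show ?thesis by (rule order_trans) (simp add: distrib_left)
    qed
    then show ?thesis
      using True \<tau> t(2) by (simp add: h_def add_diff_eq)
  qed simp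
  have "AE \<tau> in lborel. ennreal (\<rho> (dist b (arclength_param \<gamma> s u \<tau>))) * indicator {0..?L} \<tau>
      \<le> ennreal (C ^ k) * (h ?p (?p + 1 * \<tau>) + h ?q ((?q + ?L) + (-1) * \<tau>))"
    using AE_lborel_singleton[of 0] AE_lborel_singleton[of ?L] by eventually_elim (rule point)
  then have "curve_integral (\<lambda>z. ennreal (\<rho> (dist b z))) \<gamma> s u
      \<le> (\<integral>\<^sup>+\<tau>. ennreal (C ^ k) * (h ?p (?p + 1 * \<tau>) + h ?q ((?q + ?L) + (-1) * \<tau>)) \<partial>lborel)"
    unfolding curve_integral_def by (rule nn_integral_mono_AE)
  also have "\<dots> = ennreal (C ^ k) * ((\<integral>\<^sup>+\<tau>. h ?p (?p + 1 * \<tau>) \<partial>lborel)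
      + (\<integral>\<^sup>+\<tau>. h ?q ((?q + ?L) + (-1) * \<tau>) \<partial>lborel))"
    by (subst nn_integral_cmult, measurable, subst nn_integral_add, measurable)
  also have "\<dots> = ennreal (C ^ k) * ((\<integral>\<^sup>+t. h ?p t \<partial>lborel) + (\<integral>\<^sup>+t. h ?q t \<partial>lborel))"
    using nn_integral_real_affine[of "h ?p" 1 ?p] nn_integral_real_affine[of "h ?q" "-1" "?q + ?L"]
    by simp
  finally show ?thesis by (simp add: h_def)
qed

lemma sph_dist_upper_bound:
  assumes unif: "uniform_metric U X" and qc: "quasi_constant C \<rho>" and b: "b \<in> bdry X"
    and meas: "\<rho> \<in> borel_measurable (restrict_space borel {0<..})"
    and U: "1 + 2 * U \<le> 2 ^ k" and xy: "x \<in> X" "y \<in> X"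
  shows "sph_dist \<rho> b X x y \<le> ennreal (C ^ k) *
    ((\<integral>\<^sup>+ t \<in> {dist b x<..}. ennreal (\<rho> t) \<partial>lborel)
      + (\<integral>\<^sup>+ t \<in> {dist b y<..}. ennreal (\<rho> t) \<partial>lborel))"
proof -
  obtain \<gamma> s u where cur: "curve_in X \<gamma> s u" and ends: "\<gamma> s = x" "\<gamma> u = y"
    and len: "curve_length \<gamma> s u \<le> ennreal (U * dist x y)"
    and cone: "\<And>t. t \<in> {s..u} \<Longrightarrow>
      min (curve_length \<gamma> s t) (curve_length \<gamma> t u) \<le> ennreal (U * infdist (\<gamma> t) (bdry X))"
    using unif xy unfolding uniform_metric_def by metis
  have rect: "rectifiable \<gamma> s u"
    using le_less_trans[OF len ennreal_less_top] by (simp add: rectifiable_def)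
  have "sph_dist \<rho> b X x y \<le> curve_integral (\<lambda>z. ennreal (\<rho> (dist b z))) \<gamma> s u"
    unfolding sph_dist_def using cur rect ends by (intro INF_lower2[where i="(\<gamma>, s, u)"]) auto
  also have "\<dots> \<le> ennreal (C ^ k) *
    ((\<integral>\<^sup>+ t \<in> {dist b x<..}. ennreal (\<rho> t) \<partial>lborel)
      + (\<integral>\<^sup>+ t \<in> {dist b y<..}. ennreal (\<rho> t) \<partial>lborel))"
    using curve_integral_uniform_le[OF qc b meas cur rect _ U cone] unif ends
    by (simp add: uniform_metric_def)
  finally show ?thesis .
qed

lemma exists_point_at_distance:
  assumes unif: "uniform_metric U X" and unb: "\<not> bounded X" and b: "b \<in> bdry X" and "0 < q"
  obtains x where "x \<in> X" "dist b x = q"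
proof -
  obtain x where x: "x \<in> X" "dist b x < q"
    using b \<open>0 < q\<close> unfolding bdry_def by (auto simp: closure_approachable dist_commute)
  obtain y where y: "y \<in> X" "q < dist b y"
    using unb unfolding bounded_def by (meson not_less)
  obtain \<gamma> s u where "curve_in X \<gamma> s u" "\<gamma> s = x" "\<gamma> u = y"
    using unif x y unfolding uniform_metric_def by metis
  then have "\<exists>t\<ge>s. t \<le> u \<and> dist b (\<gamma> t) = q"
    using x y by (intro IVT') (auto simp: curve_in_def intro!: continuous_intros)
  then obtain t where "t \<in> {s..u}" "dist b (\<gamma> t) = q" by auto
  then show ?thesis
    using that[of "\<gamma> t"] \<open>curve_in X \<gamma> s u\<close> by (auto simp: curve_in_def image_subset_iff)
qed

lemma doubling_iterate:
  fixes r :: real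
  assumes "\<And>r. r > 0 \<Longrightarrow> emeasure M (B (2 * r)) \<le> ennreal C * emeasure M (B r)" and "0 \<le> C" "0 < r"
  shows "emeasure M (B (2 ^ n * r)) \<le> ennreal (C ^ n) * emeasure M (B r)"
proof (induction n)
  case (Suc n)
  have "emeasure M (B (2 ^ Suc n * r)) \<le> ennreal C * emeasure M (B (2 ^ n * r))"
    using assms(1)[of "2 ^ n * r"] \<open>0 < r\<close> by (simp add: mult.assoc)
  also have "\<dots> \<le> ennreal C * (ennreal (C ^ n) * emeasure M (B r))"
    by (intro mult_left_mono Suc.IH) simp
  finally show ?case
    using \<open>0 \<le> C\<close> by (simp add: ennreal_mult mult.assoc)
qed simp

section \<open>Failure of the doubling property\<close>

text \<open>
  The quotients \<open>0 / 0\<close> and \<open>\<infinity> / \<infinity>\<close> are \<open>0\<close> for \<^typ>\<open>ennreal\<close>, so degenerate denominators do no harm.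
\<close>

lemma ennreal_divide_le:
  fixes a d :: ennreal
  assumes "a \<le> ennreal K * d"
  shows "a / d \<le> ennreal K"
proof (cases "d = 0 \<or> d = \<infinity>")
  case True
  then show ?thesis using assms by auto
next
  case False
  have "a / d \<le> ennreal K * d / d" by (rule divide_right_mono_ennreal[OF assms])
  also have "\<dots> = ennreal K"
    using False by (intro ennreal_mult_divide_eq) auto
  finally show ?thesis .
qed

lemma weight_measurable:
  assumes reg: "borel_regular_on X M" and b: "b \<in> bdry X"
    and meas: "\<rho> \<in> borel_measurable (restrict_space borel {0<..})"
  shows "(\<lambda>x. ennreal (\<rho> (dist b x) powr \<sigma>)) \<in> borel_measurable M"
proof -
  have sp: "space M = X" and sub: "sets (restrict_space borel X) \<subseteq> sets M"
    using reg by (auto simp: borel_regular_on_def)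
  have "(\<lambda>x. dist b x) \<in> measurable (restrict_space borel X) borel"
    by (intro measurable_restrict_space1 borel_measurable_continuous_onI continuous_intros)
  then have "(\<lambda>x. dist b x) \<in> measurable M borel"
    using sp sub by (auto simp: measurable_def space_restrict_space)
  then have "(\<lambda>x. dist b x) \<in> measurable M (restrict_space borel {0<..})"
    using dist_bdry_pos[OF b] sp by (intro measurable_restrict_space2) auto
  from measurable_compose[OF this meas]
  have [measurable]: "(\<lambda>x. \<rho> (dist b x)) \<in> borel_measurable M" .
  show ?thesis by simp
qed

lemma sball_measurable:
  assumes "borel_regular_on X M"
  shows "sball X x r \<in> sets M"
proof -
  have "sball X x r = X \<inter> ball x r" by (auto simp: sball_def)
  also have "\<dots> \<in> sets (restrict_space borel X)" by (auto simp: sets_restrict_space)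
  finally show ?thesis using assms by (auto simp: borel_regular_on_def)
qed

theorem theorem4p5:
  fixes X :: "'a::complete_space set" and M :: "'a measure" and b :: 'a
    and \<rho> :: "real \<Rightarrow> real" and C\<^sub>U C\<^sub>A C\<^sub>B \<sigma> :: real
  assumes "uniform_metric C\<^sub>U X"
    and "\<not> bounded X"
    and "borel_regular_on X M"
    and "doubling X (sball X) M"
    and "b \<in> bdry X"
    and "\<sigma> > 0"
    and "\<rho> \<in> borel_measurable (restrict_space borel {0<..})"
    and "\<And>t. t > 0 \<Longrightarrow> \<rho> t > 0"
    and "(\<integral>\<^sup>+ t \<in> {0<..}. ennreal (\<rho> t) \<partial>lborel) < \<infinity>"
    and "C\<^sub>A > 0" and "C\<^sub>B > 0"
    and "\<And>r s. 0 < r \<Longrightarrow> r \<le> 2 * s + 1 \<Longrightarrow> 0 < s \<Longrightarrow> s \<le> 2 * r + 1 \<Longrightarrow> \<rho> r \<le> C\<^sub>A * \<rho> s"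
    and "\<And>r. r > 0 \<Longrightarrow> (\<integral>\<^sup>+ t \<in> {r<..}. ennreal (\<rho> t) \<partial>lborel) \<le> ennreal (C\<^sub>B * (r + 1) * \<rho> r)"
    and "(SUP r \<in> {0<..}.
            (\<integral>\<^sup>+ x \<in> X - sball X b r. ennreal (\<rho> (dist b x) powr \<sigma>) \<partial>M)
              / (ennreal (\<rho> r powr \<sigma>) * emeasure M (sball X b (r + 1)))) = \<infinity>"
  shows "\<not> doubling X (sph_ball \<rho> b X) (sph_measure \<rho> b \<sigma> M)"
proof
  assume dbl: "doubling X (sph_ball \<rho> b X) (sph_measure \<rho> b \<sigma> M)"
  note unif = assms(1) and reg = assms(3) and b = assms(5) and meas = assms(7)
  have qc: "quasi_constant C\<^sub>A \<rho>"
    using assms(8,12) by (simp add: quasi_constant_def)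
  have CA: "C\<^sub>A \<ge> 1" by (rule quasi_constant_ge_1[OF qc])
  let ?\<mu> = "sph_measure \<rho> b \<sigma> M" and ?B = "sph_ball \<rho> b X"
  obtain C where C: "C > 1"
    and C_pos: "\<And>x r. x \<in> X \<Longrightarrow> r > 0 \<Longrightarrow> 0 < emeasure ?\<mu> (?B x (2 * r))"
    and C_dbl: "\<And>x r. x \<in> X \<Longrightarrow> r > 0 \<Longrightarrow> emeasure ?\<mu> (?B x (2 * r)) \<le> ennreal C * emeasure ?\<mu> (?B x r)"
    using dbl unfolding doubling_def by blast
  have sets_\<mu>: "sets ?\<mu> = sets M" by (simp add: sph_measure_def)
  \<comment> \<open>A nonmeasurable set has measure 0, so the positivity in the doubling property gives measurability.\<close>
  have ball_meas: "?B x r \<in> sets M" if "x \<in> X" "r > 0" for x r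
  proof (rule ccontr)
    assume "?B x r \<notin> sets M"
    then have "emeasure ?\<mu> (?B x r) = 0" by (simp add: emeasure_notin_sets sets_\<mu>)
    then show False using C_pos[of x "r / 2"] that by simp
  qed
  have \<mu>_eq: "emeasure ?\<mu> A = (\<integral>\<^sup>+ x \<in> A. ennreal (\<rho> (dist b x) powr \<sigma>) \<partial>M)" if "A \<in> sets M" for A
    unfolding sph_measure_def by (rule emeasure_density[OF weight_measurable[OF reg b meas] that])

  obtain k where k: "1 + 2 * C\<^sub>U \<le> 2 ^ k"
    using real_arch_pow[of 2 "1 + 2 * C\<^sub>U"] by (auto intro: less_imp_le)
  define K where "K = 2 * C\<^sub>A ^ k * C\<^sub>B"
  obtain N where N: "2 * C\<^sub>A * K < 2 ^ N"
    using real_arch_pow[of 2 "2 * C\<^sub>A * K"] by auto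
  define D where "D = C ^ N * (C\<^sub>A\<^sup>2) powr \<sigma>"
  have bound: "(\<integral>\<^sup>+ x \<in> X - sball X b r. ennreal (\<rho> (dist b x) powr \<sigma>) \<partial>M)
      \<le> ennreal D * (ennreal (\<rho> r powr \<sigma>) * emeasure M (sball X b (r + 1)))"
    if "r > 0" for r
  proof -
    \<comment> \<open>The center lies well inside \<open>B(b,r)\<close>: then the ball of radius \<open>(q + 1) / 2\<close> about \<open>x\<close> is contained
        in \<open>B(b,r+1)\<close>, while \<open>\<rho> q\<close> and \<open>\<rho> r\<close> are still comparable.\<close>
    define q where "q = r / 2"
    have q: "q > 0" using that by (simp add: q_def)
    obtain x where x: "x \<in> X" "dist b x = q"
      using exists_point_at_distance[OF unif assms(2) b q] .
    define \<epsilon> where "\<epsilon> = (q + 1) / 2 * (\<rho> q / C\<^sub>A)"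
    have \<rho>q: "\<rho> q > 0" and \<rho>r: "\<rho> r > 0" using q that assms(8) by auto
    have \<epsilon>: "\<epsilon> > 0" using q \<rho>q CA by (simp add: \<epsilon>_def)

    \<comment> \<open>The number \<open>N\<close> of doublings that reaches all far points depends only on the constants, not on \<open>r\<close>.\<close>
    have "X - sball X b r \<subseteq> ?B x (2 ^ N * \<epsilon>)"
    proof
      fix y assume "y \<in> X - sball X b r"
      then have y: "y \<in> X" "q \<le> dist b y" using q by (auto simp: sball_def q_def)
      have "(\<integral>\<^sup>+ t \<in> {dist b y<..}. ennreal (\<rho> t) \<partial>lborel) \<le> (\<integral>\<^sup>+ t \<in> {q<..}. ennreal (\<rho> t) \<partial>lborel)"
        using y by (intro nn_integral_mono) (auto split: split_indicator)
      then have "sph_dist \<rho> b X x y \<le> ennreal (C\<^sub>A ^ k) *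
          ((\<integral>\<^sup>+ t \<in> {q<..}. ennreal (\<rho> t) \<partial>lborel) + (\<integral>\<^sup>+ t \<in> {q<..}. ennreal (\<rho> t) \<partial>lborel))"
        using sph_dist_upper_bound[OF unif qc b meas k x(1) y(1)] x(2)
        by (auto elim!: order_trans intro!: mult_left_mono add_left_mono)
      also have "\<dots> \<le> ennreal (C\<^sub>A ^ k) *
          (ennreal (C\<^sub>B * (q + 1) * \<rho> q) + ennreal (C\<^sub>B * (q + 1) * \<rho> q))"
        using assms(13)[OF q] by (intro mult_left_mono add_mono) auto
      also have "\<dots> = ennreal (K * ((q + 1) * \<rho> q))"
        using CA assms(11) q \<rho>q
        by (simp add: ennreal_plus[symmetric] ennreal_mult'[symmetric] K_def algebra_simps del: ennreal_plus)
      also have "\<dots> < ennreal (2 ^ N * \<epsilon>)"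
      proof (rule ennreal_lessI)
        have "K * ((q + 1) * \<rho> q) = 2 * C\<^sub>A * K * \<epsilon>"
          using CA by (simp add: \<epsilon>_def field_simps)
        also have "\<dots> < 2 ^ N * \<epsilon>"
          using N \<epsilon> by (rule mult_strict_right_mono)
        finally show "K * ((q + 1) * \<rho> q) < 2 ^ N * \<epsilon>" .
      qed (use \<epsilon> in simp)
      finally show "y \<in> ?B x (2 ^ N * \<epsilon>)"
        using y by (simp add: sph_ball_def)
    qed
    then have "(\<integral>\<^sup>+ x \<in> X - sball X b r. ennreal (\<rho> (dist b x) powr \<sigma>) \<partial>M)
        \<le> emeasure ?\<mu> (?B x (2 ^ N * \<epsilon>))"
      using x \<epsilon> by (subst \<mu>_eq) (auto intro!: ball_meas nn_integral_mono split: split_indicator)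
    also have "\<dots> \<le> ennreal (C ^ N) * emeasure ?\<mu> (?B x \<epsilon>)"
      using C C_dbl[OF x(1)] \<epsilon> by (intro doubling_iterate) auto
    also have "emeasure ?\<mu> (?B x \<epsilon>)
        \<le> ennreal ((C\<^sub>A\<^sup>2 * \<rho> r) powr \<sigma>) * emeasure M (sball X b (r + 1))"
    proof -
      have "\<rho> (dist b z) powr \<sigma> \<le> (C\<^sub>A\<^sup>2 * \<rho> r) powr \<sigma> \<and> z \<in> sball X b (r + 1)" if z: "z \<in> ?B x \<epsilon>" for z
      proof
        have z': "z \<in> X" "dist x z < (q + 1) / 2"
          using sph_ball_subset_sball[OF qc b, where x=x] x z by (auto simp: \<epsilon>_def sball_def)
        have tri: "dist b z \<le> q + dist x z" "q \<le> dist b z + dist x z"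
          using dist_triangle[of b z x] dist_triangle[of b x z] x by (auto simp: dist_commute)
        then show "z \<in> sball X b (r + 1)"
          using z' q by (auto simp: sball_def q_def)
        have pos: "0 < dist b z" by (rule dist_bdry_pos[OF b z'(1)])
        have "\<rho> (dist b z) \<le> C\<^sub>A * \<rho> q"
          using z' q tri pos by (intro quasi_constantD[OF qc]) auto
        also have "\<dots> \<le> C\<^sub>A * (C\<^sub>A * \<rho> r)"
          using CA q by (intro mult_left_mono quasi_constantD[OF qc]) (auto simp: q_def)
        finally show "\<rho> (dist b z) powr \<sigma> \<le> (C\<^sub>A\<^sup>2 * \<rho> r) powr \<sigma>"
          using assms(6) assms(8)[OF pos]
          by (intro powr_mono2) (auto simp: power2_eq_square mult.assoc)
      qed
      then have "emeasure ?\<mu> (?B x \<epsilon>)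
          \<le> (\<integral>\<^sup>+ z. ennreal ((C\<^sub>A\<^sup>2 * \<rho> r) powr \<sigma>) * indicator (sball X b (r + 1)) z \<partial>M)"
        using x \<epsilon> by (subst \<mu>_eq)
          (auto intro!: ball_meas nn_integral_mono ennreal_leI split: split_indicator)
      also have "\<dots> = ennreal ((C\<^sub>A\<^sup>2 * \<rho> r) powr \<sigma>) * emeasure M (sball X b (r + 1))"
        by (intro nn_integral_cmult_indicator sball_measurable[OF reg])
      finally show ?thesis .
    qed
    also have "ennreal (C ^ N) * (ennreal ((C\<^sub>A\<^sup>2 * \<rho> r) powr \<sigma>) * emeasure M (sball X b (r + 1)))
        = ennreal D * (ennreal (\<rho> r powr \<sigma>) * emeasure M (sball X b (r + 1)))"
      using C \<rho>r by (simp add: D_def powr_mult ennreal_mult mult.assoc)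
    finally show ?thesis by (simp add: mult_left_mono)
  qed
  have "(SUP r \<in> {0<..}.
      (\<integral>\<^sup>+ x \<in> X - sball X b r. ennreal (\<rho> (dist b x) powr \<sigma>) \<partial>M)
        / (ennreal (\<rho> r powr \<sigma>) * emeasure M (sball X b (r + 1)))) \<le> ennreal D"
    by (intro SUP_least ennreal_divide_le bound) simp
  then show False
    using assms(14) by (simp add: top_unique)
qed

end
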